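(* Let $T : G \curvearrowright (X, \mu)$ be a measure-preserving action of a discrete group $G$ on a probability space $(X, \mu)$. Let $f \in L^1(X, \mu)$, and let $(F_k)_{k=1}^\infty$ be a sequence of nonempty finite subsets of $G$ such that the sequence $\left( \operatorname{Avg}_{F_k} f \right)_{k=1}^\infty$ converges to a function $f^* \in L^1(X,\mu)$ in the weak topology on $L^1(X,\mu)$. Then for every measurable subset $C$ of $X$ with positive measure, $$\lim_{k \to \infty} \alpha_C\left( \operatorname{Avg}_{F_k} f \right) = \alpha_C\left( f^* \right) .$$
   Context: For a nonempty finite $K \subseteq G$, $\operatorname{Avg}_K f = \frac{1}{|K|} \sum_{g \in K} f \circ T_g$. For a measurable $C \subseteq X$ with $\mu(C)>0$ and $h \in L^1(X,\mu)$, $\alpha_C(h) = \frac{1}{\mu(C)} \int_C h \, \mathrm{d}\mu$. *)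

theory Defs
  imports "HOL-Probability.Probability" "HOL-Algebra.Group_Action"
begin

text \<open>
  The scalars are any type of sort \<open>{real_normed_field, banach, second_countable_topology}\<close>,
  so that real and complex \<open>L\<^sup>1\<close> are covered simultaneously. Elements of \<open>L\<^sup>1\<close> are represented by
  integrable functions, not by classes modulo almost everywhere equality.
\<close>

locale measure_preserving_action =
  prob_space M + group_action G "space M" T
  for G :: "('g, 'r) monoid_scheme" (structure)
    and M :: "'a measure"
    and T :: "'g \<Rightarrow> 'a \<Rightarrow> 'a" +
  assumes measurable_act: "g \<in> carrier G \<Longrightarrow> T g \<in> measurable M M"
    and distr_act: "g \<in> carrier G \<Longrightarrow> distr M M (T g) = M"

definition Avg :: "('g \<Rightarrow> 'a \<Rightarrow> 'a) \<Rightarrow> 'g set \<Rightarrow> ('a \<Rightarrow> 'b::real_vector) \<Rightarrow> 'a \<Rightarrow> 'b" where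
  "Avg T K f = (\<lambda>x. (1 / real (card K)) *\<^sub>R (\<Sum>g\<in>K. (f \<circ> T g) x))"

definition set_avg :: "'a measure \<Rightarrow> 'a set \<Rightarrow> ('a \<Rightarrow> 'b) \<Rightarrow> 'b::{banach, second_countable_topology}"
  where "set_avg M C h = (1 / measure M C) *\<^sub>R (LINT x:C|M. h x)"

text \<open>
  The continuous linear functionals on \<open>L\<^sup>1\<close>. The norm bound together with linearity forces such a
  functional to agree on almost everywhere equal functions, so it descends to the quotient.
  Values at non-integrable functions are irrelevant.
\<close>

definition L1_dual ::
  "'a measure \<Rightarrow> (('a \<Rightarrow> 'b) \<Rightarrow> 'b::{real_normed_field, banach, second_countable_topology}) set"
  where "L1_dual M = {\<phi>.
    (\<forall>u v. integrable M u \<longrightarrow> integrable M v \<longrightarrow> \<phi> (\<lambda>x. u x + v x) = \<phi> u + \<phi> v) \<and>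
    (\<forall>c u. integrable M u \<longrightarrow> \<phi> (\<lambda>x. c * u x) = c * \<phi> u) \<and>
    (\<exists>B. \<forall>u. integrable M u \<longrightarrow> norm (\<phi> u) \<le> B * (LINT x|M. norm (u x)))}"

text \<open>
  The coarsest topology on the integrable functions making every element of the dual continuous,
  i.e. the pullback of the weak topology along the quotient map onto \<open>L\<^sup>1\<close>.
  Limits are therefore unique only almost everywhere.
\<close>

definition weak_L1_topology ::
  "'a measure \<Rightarrow> ('a \<Rightarrow> 'b::{real_normed_field, banach, second_countable_topology}) topology"
  where "weak_L1_topology M =
    topology_generated_by {{u. integrable M u \<and> \<phi> u \<in> U} | \<phi> U. \<phi> \<in> L1_dual M \<and> open U}"

end

theory Submission
  imports Defs
begin

text \<open>Weak convergence can be tested against each continuous functional separately, so the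
  claim is the case of the single functional \<open>set_avg M C\<close>.
  \<open>set_avg_in_L1_dual\<close> supplies the functional, with the bound coming from
  |\<integral>_C u| \<le> \<integral>_C |u| \<le> \<integral> |u|;
  \<open>limitin_weak_L1_imp_tendsto\<close> passes from the topology to convergence of
  values.\<close>

text \<open>
  The average over \<open>C\<close> is a continuous linear functional on \<open>L\<^sup>1\<close>, bounded by \<open>1 / \<mu>(C)\<close>,
  so it preserves weak limits.
\<close>

lemma set_avg_in_L1_dual:
  fixes M :: "'a measure"
  assumes C: "C \<in> sets M"
  shows "(set_avg M C :: ('a \<Rightarrow> 'b::{real_normed_field, banach, second_countable_topology}) \<Rightarrow> 'b)
    \<in> L1_dual M"
proof -
  have int: "set_integrable M C u" if "integrable M u" for u :: "'a \<Rightarrow> 'b"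
    unfolding set_integrable_def using C that by (rule integrable_mult_indicator)
  have add: "set_avg M C (\<lambda>x. u x + v x) = set_avg M C u + set_avg M C v"
    if "integrable M u" "integrable M v" for u v :: "'a \<Rightarrow> 'b"
    using that by (simp add: set_avg_def set_integral_add int scaleR_add_right)
  have scale: "set_avg M C (\<lambda>x. c * u x) = c * set_avg M C u"
    if "integrable M u" for c and u :: "'a \<Rightarrow> 'b"
    by (simp add: set_avg_def)
  have bound: "norm (set_avg M C u) \<le> (1 / measure M C) * (LINT x|M. norm (u x))"
    if u: "integrable M u" for u :: "'a \<Rightarrow> 'b"
  proof -
    have "norm (LINT x:C|M. u x) \<le> (LINT x:C|M. norm (u x))"
      by (rule set_integral_norm_bound[OF int[OF u]])
    also have "\<dots> \<le> (LINT x|M. norm (u x))"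
      unfolding set_lebesgue_integral_def using C u
      by (intro integral_mono integrable_mult_indicator integrable_norm)
        (auto simp: indicator_def)
    \<comment> \<open>For a null set \<open>C\<close> the factor \<open>1 / measure M C\<close> is
      \<open>0\<close> by convention, and the bound reads 0 \<le> 0.\<close>
    finally show ?thesis
      by (simp add: set_avg_def divide_right_mono)
  qed
  show ?thesis
    unfolding L1_dual_def using add scale bound by blast
qed

text \<open>The preimage of an open set under \<phi>, cut down to the integrable functions, is one
  of the generating open sets, so a weakly convergent family is eventually inside it whenever its
  limit is.\<close>

lemma limitin_weak_L1_imp_tendsto:
  fixes u :: "'i \<Rightarrow> 'a \<Rightarrow> 'b::{real_normed_field, banach, second_countable_topology}"
  assumes lim: "limitin (weak_L1_topology M) u v F"
    and phi: "\<phi> \<in> L1_dual M"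
  shows "((\<lambda>i. \<phi> (u i)) \<longlongrightarrow> \<phi> v) F"
proof (rule topological_tendstoI)
  fix U :: "'b set"
  assume U: "open U" "\<phi> v \<in> U"
  have sub: "openin (weak_L1_topology M) {w. integrable M w \<and> \<psi> w \<in> V}"
    if "\<psi> \<in> L1_dual M" "open V" for \<psi> and V :: "'b set"
    unfolding weak_L1_topology_def using that by (intro topology_generated_by_Basis) blast
  \<comment> \<open>The generating sets contain only integrable functions, so a limit, being a point
    of their union, is integrable. This is what places \<open>v\<close> in the preimage of
    \<open>U\<close>.\<close>
  have "v \<in> topspace (weak_L1_topology M)"
    using lim by (rule limitin_topspace)
  then have "integrable M v"
    unfolding weak_L1_topology_def topology_generated_by_topspace by blast
  with U have "\<forall>\<^sub>F i in F. u i \<in> {w. integrable M w \<and> \<phi> w \<in> U}"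
    using lim sub[OF phi] unfolding limitin_def by blast
  then show "\<forall>\<^sub>F i in F. \<phi> (u i) \<in> U"
    by (rule eventually_mono) blast
qed

theorem proposition2p1:
  fixes G :: "('g, 'r) monoid_scheme"
    and M :: "'a measure"
    and T :: "'g \<Rightarrow> 'a \<Rightarrow> 'a"
    and f f' :: "'a \<Rightarrow> 'b::{real_normed_field, banach, second_countable_topology}"
    and F :: "nat \<Rightarrow> 'g set"
    and C :: "'a set"
  assumes "measure_preserving_action G M T"
    and "integrable M f"
    and "\<And>k. k \<ge> 1 \<Longrightarrow> F k \<subseteq> carrier G \<and> finite (F k) \<and> F k \<noteq> {}"
    and "integrable M f'"
    and "limitin (weak_L1_topology M) (\<lambda>k. Avg T (F k) f) f' sequentially"
    and "C \<in> sets M"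
    and "measure M C > 0"
  shows "(\<lambda>k. set_avg M C (Avg T (F k) f)) \<longlonglongrightarrow> set_avg M C f'"
  using assms(5) set_avg_in_L1_dual[OF assms(6)] by (rule limitin_weak_L1_imp_tendsto)

end
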